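(* Let $(Y, \to_Y)$ be a strong space. The following are equivalent: (i) for every topological space $X$ and every open-irreducible map $f: X \to Y$, there is an open implication $\to_X$ over $\mathcal{O}(X)$ with $f^{-1}(U \to_Y V) = f^{-1}(U) \to_X f^{-1}(V)$ for all $U, V \in \mathcal{O}(Y)$; (ii) for every topological space $X$ and every open-irreducible map $f: X \to Y$, there is an implication $\to_X$ over $\mathcal{O}(X)$ with $f^{-1}(U \to_Y V) = f^{-1}(U) \to_X f^{-1}(V)$ for all $U, V \in \mathcal{O}(Y)$; (iii) for every topological space $X$ and every open embedding $f: X \to Y$, there is an implication $\to_X$ over $\mathcal{O}(X)$ with $f^{-1}(U \to_Y V) = f^{-1}(U) \to_X f^{-1}(V)$ for all $U, V \in \mathcal{O}(Y)$; (iv) $\to_Y$ is open localizable: for every open $Z \subseteq Y$ and all $U_1, V_1, U_2, V_2 \in \mathcal{O}(Y)$, if $U_1 \cap Z = U_2 \cap Z$ and $V_1 \cap Z = V_2 \cap Z$, then $(U_1 \to_Y V_1) \cap Z = (U_2 \to_Y V_2) \cap Z$; (v) $\to_Y$ is open. Likewise, the following are equivalent: (i') for every space $X$ and every closed-irreducible map $f: X \to Y$ there is a closed implication $\to_X$ over $\mathcal{O}(X)$ with $f^{-1}(U \to_Y V) = f^{-1}(U) \to_X f^{-1}(V)$ for all $U,V \in \mathcal{O}(Y)$; (ii') for every space $X$ and every closed-irreducible map $f: X \to Y$ there is an implication $\to_X$ over $\mathcal{O}(X)$ with the same property; (iii') for every space $X$ and every closed embedding $f: X \to Y$ there is an implication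 $\to_X$ over $\mathcal{O}(X)$ with the same property; (iv') $\to_Y$ is closed localizable: for every closed $Z \subseteq Y$ and all $U_1, V_1, U_2, V_2 \in \mathcal{O}(Y)$, if $U_1 \cap Z = U_2 \cap Z$ and $V_1 \cap Z = V_2 \cap Z$, then $(U_1 \to_Y V_1) \cap Z = (U_2 \to_Y V_2) \cap Z$; (v') $\to_Y$ is closed.
   Context: For a bounded distributive lattice $\mathcal{A}$, an implication over $\mathcal{A}$ is a binary operation $\to$ on $\mathcal{A}$ which is order-reversing in its first argument and order-preserving in its second argument and satisfies $a \to a = 1$ and $(a \to b) \wedge (b \to c) \leq a \to c$ for all $a,b,c$. An implication is open if $a \wedge b \leq c$ implies $a \leq b \to c$; closed if $a \leq b \vee c$ implies $(a \to b) \vee c = 1$. For a topological space $X$, $\mathcal{O}(X)$ is the locale of open subsets ordered by inclusion; a strong space is a pair $(X,\to)$ with $\to$ an implication over $\mathcal{O}(X)$. A continuous map $f: X \to Y$ is open-irreducible if it is an open map and $f[A] \cap f[B] = f[A \cap B]$ for all open $A, B \subseteq X$; it is closed-irreducible if it is a closed map and $f[A] \cap f[B] = f[A \cap B]$ for all closed $A, B \subseteq X$. An open (closed) embedding is a topological embedding with open (closed) image. *)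

theory Defs
  imports "HOL-Analysis.Analysis"
begin

text \<open>
  The locale \<open>\<O>(X)\<close> is the set of all \<open>U\<close> with \<open>openin X U\<close>, ordered by inclusion: its top is
  \<open>topspace X\<close>, and its binary meets and joins are intersection and union. A binary operation on
  it is a total function on sets of which only the values on open arguments matter.
\<close>

type_synonym 'a set_op = "'a set \<Rightarrow> 'a set \<Rightarrow> 'a set"

definition implication :: "'a topology \<Rightarrow> 'a set_op \<Rightarrow> bool" where
  "implication X imp \<longleftrightarrow>
     (\<forall>U V. openin X U \<longrightarrow> openin X V \<longrightarrow> openin X (imp U V)) \<and>
     (\<forall>U U' V. openin X U \<longrightarrow> openin X U' \<longrightarrow> openin X V \<longrightarrow>
        U \<subseteq> U' \<longrightarrow> imp U' V \<subseteq> imp U V) \<and>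
     (\<forall>U V V'. openin X U \<longrightarrow> openin X V \<longrightarrow> openin X V' \<longrightarrow>
        V \<subseteq> V' \<longrightarrow> imp U V \<subseteq> imp U V') \<and>
     (\<forall>U. openin X U \<longrightarrow> imp U U = topspace X) \<and>
     (\<forall>U V W. openin X U \<longrightarrow> openin X V \<longrightarrow> openin X W \<longrightarrow>
        imp U V \<inter> imp V W \<subseteq> imp U W)"

definition open_implication :: "'a topology \<Rightarrow> 'a set_op \<Rightarrow> bool" where
  "open_implication X imp \<longleftrightarrow>
     implication X imp \<and>
     (\<forall>U V W. openin X U \<longrightarrow> openin X V \<longrightarrow> openin X W \<longrightarrow>
        U \<inter> V \<subseteq> W \<longrightarrow> U \<subseteq> imp V W)"

definition closed_implication :: "'a topology \<Rightarrow> 'a set_op \<Rightarrow> bool" where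
  "closed_implication X imp \<longleftrightarrow>
     implication X imp \<and>
     (\<forall>U V W. openin X U \<longrightarrow> openin X V \<longrightarrow> openin X W \<longrightarrow>
        U \<subseteq> V \<union> W \<longrightarrow> imp U V \<union> W = topspace X)"

definition open_irreducible :: "'b topology \<Rightarrow> 'a topology \<Rightarrow> ('b \<Rightarrow> 'a) \<Rightarrow> bool" where
  "open_irreducible X Y f \<longleftrightarrow>
     continuous_map X Y f \<and> open_map X Y f \<and>
     (\<forall>A B. openin X A \<longrightarrow> openin X B \<longrightarrow> f ` A \<inter> f ` B = f ` (A \<inter> B))"

definition closed_irreducible :: "'b topology \<Rightarrow> 'a topology \<Rightarrow> ('b \<Rightarrow> 'a) \<Rightarrow> bool" where
  "closed_irreducible X Y f \<longleftrightarrow>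
     continuous_map X Y f \<and> closed_map X Y f \<and>
     (\<forall>A B. closedin X A \<longrightarrow> closedin X B \<longrightarrow> f ` A \<inter> f ` B = f ` (A \<inter> B))"

definition open_embedding :: "'b topology \<Rightarrow> 'a topology \<Rightarrow> ('b \<Rightarrow> 'a) \<Rightarrow> bool" where
  "open_embedding X Y f \<longleftrightarrow> embedding_map X Y f \<and> openin Y (f ` topspace X)"

definition closed_embedding :: "'b topology \<Rightarrow> 'a topology \<Rightarrow> ('b \<Rightarrow> 'a) \<Rightarrow> bool" where
  "closed_embedding X Y f \<longleftrightarrow> embedding_map X Y f \<and> closedin Y (f ` topspace X)"

definition open_localizable :: "'a topology \<Rightarrow> 'a set_op \<Rightarrow> bool" where
  "open_localizable Y imp \<longleftrightarrow>
     (\<forall>Z U1 V1 U2 V2. openin Y Z \<longrightarrow>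
        openin Y U1 \<longrightarrow> openin Y V1 \<longrightarrow> openin Y U2 \<longrightarrow> openin Y V2 \<longrightarrow>
        U1 \<inter> Z = U2 \<inter> Z \<longrightarrow> V1 \<inter> Z = V2 \<inter> Z \<longrightarrow> imp U1 V1 \<inter> Z = imp U2 V2 \<inter> Z)"

definition closed_localizable :: "'a topology \<Rightarrow> 'a set_op \<Rightarrow> bool" where
  "closed_localizable Y imp \<longleftrightarrow>
     (\<forall>Z U1 V1 U2 V2. closedin Y Z \<longrightarrow>
        openin Y U1 \<longrightarrow> openin Y V1 \<longrightarrow> openin Y U2 \<longrightarrow> openin Y V2 \<longrightarrow>
        U1 \<inter> Z = U2 \<inter> Z \<longrightarrow> V1 \<inter> Z = V2 \<inter> Z \<longrightarrow> imp U1 V1 \<inter> Z = imp U2 V2 \<inter> Z)"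

text \<open>Preimages are cut down to \<open>topspace X\<close>, since \<open>f\<close> is a total function on the type.\<close>

definition preserves_implication ::
    "'b topology \<Rightarrow> 'b set_op \<Rightarrow> 'a topology \<Rightarrow> 'a set_op \<Rightarrow> ('b \<Rightarrow> 'a) \<Rightarrow> bool" where
  "preserves_implication X impX Y impY f \<longleftrightarrow>
     (\<forall>U V. openin Y U \<longrightarrow> openin Y V \<longrightarrow>
        f -` impY U V \<inter> topspace X = impX (f -` U \<inter> topspace X) (f -` V \<inter> topspace X))"

text \<open>
  For every space \<open>X\<close> with points in the type \<open>'b\<close> and every map \<open>f\<close> from \<open>X\<close> to \<open>Y\<close> in the class
  \<open>M\<close>, there is an implication of the kind \<open>C\<close> over the opens of \<open>X\<close> that is preserved by the
  preimage under \<open>f\<close>. The first argument only names the type \<open>'b\<close>: HOL has no quantifier over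
  types inside formulas. ``Every topological space'' is rendered by combining the type of the
  points of \<open>Y\<close>, which carries a copy of each subspace of \<open>Y\<close>, with a second, arbitrary type.
\<close>

definition pulls_back_along ::
    "'b itself \<Rightarrow> ('b topology \<Rightarrow> 'a topology \<Rightarrow> ('b \<Rightarrow> 'a) \<Rightarrow> bool) \<Rightarrow>
     ('b topology \<Rightarrow> 'b set_op \<Rightarrow> bool) \<Rightarrow> 'a topology \<Rightarrow> 'a set_op \<Rightarrow> bool" where
  "pulls_back_along T M C Y impY \<longleftrightarrow>
     (\<forall>(X :: 'b topology) f. M X Y f \<longrightarrow>
        (\<exists>impX. C X impX \<and> preserves_implication X impX Y impY f))"

definition all_equivalent :: "bool list \<Rightarrow> bool" where
  "all_equivalent Ps \<longleftrightarrow> (\<forall>P\<in>set Ps. \<forall>Q\<in>set Ps. P \<longleftrightarrow> Q)"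

end

theory Submission
  imports Defs
begin

text \<open>
  Both localizability and openness (closedness) of an implication
  say the same thing about each open (closed) set \<open>Z\<close>: if \<open>U \<inter> Z \<subseteq> V\<close> then \<open>Z \<subseteq> U \<rightarrow> V\<close>. One
  direction compares \<open>U \<rightarrow> V\<close> with \<open>U \<inter> V \<rightarrow> V\<close>, which is everything; the other composes \<open>U\<^sub>1 \<rightarrow> V\<^sub>1\<close>
  with \<open>U\<^sub>2 \<rightarrow> U\<^sub>1\<close> and \<open>V\<^sub>1 \<rightarrow> V\<^sub>2\<close>, both of which contain \<open>Z\<close>. Restricting to the
  subspace \<open>Z\<close> shows localizability at \<open>Z\<close>. Conversely, for \<open>f\<close> with image \<open>Z\<close>, an implication on \<open>X\<close> is obtained as \<open>f\<^sup>-\<^sup>1(g U \<rightarrow> g V)\<close>, where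
  \<open>g\<close> is the direct image \<open>U \<mapsto> f[U]\<close> in the open case and \<open>U \<mapsto> Y - f[X - U]\<close> in the closed case;
  as \<open>g(f\<^sup>-\<^sup>1 U) \<inter> Z = U \<inter> Z\<close>, localizability at \<open>Z\<close> shows that \<open>f\<^sup>-\<^sup>1\<close> preserves it.
\<close>

section \<open>Basic rules for implications, open implications and closed implications\<close>

lemma implicationD:
  assumes "implication X imp"
  shows implication_openin: "\<And>U V. openin X U \<Longrightarrow> openin X V \<Longrightarrow> openin X (imp U V)"
    and implication_antimono: "\<And>U U' V. openin X U \<Longrightarrow> openin X U' \<Longrightarrow> openin X V \<Longrightarrow>
      U \<subseteq> U' \<Longrightarrow> imp U' V \<subseteq> imp U V"
    and implication_mono: "\<And>U V V'. openin X U \<Longrightarrow> openin X V \<Longrightarrow> openin X V' \<Longrightarrow>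
      V \<subseteq> V' \<Longrightarrow> imp U V \<subseteq> imp U V'"
    and implication_refl: "\<And>U. openin X U \<Longrightarrow> imp U U = topspace X"
    and implication_trans: "\<And>U V W. openin X U \<Longrightarrow> openin X V \<Longrightarrow> openin X W \<Longrightarrow>
      imp U V \<inter> imp V W \<subseteq> imp U W"
  using assms unfolding implication_def by (elim conjE, simp only:)+

lemma implication_le:
  assumes "implication X imp" "openin X U" "openin X V" "U \<subseteq> V"
  shows "imp U V = topspace X"
  using implication_mono[OF assms(1) assms(2) assms(2) assms(3) assms(4)]
    implication_refl[OF assms(1,2)] openin_subset[OF implication_openin[OF assms(1-3)]]
  by blast

lemma open_implicationI:
  assumes "implication X imp"
    and "\<And>U V W. openin X U \<Longrightarrow> openin X V \<Longrightarrow> openin X W \<Longrightarrow> U \<inter> V \<subseteq> W \<Longrightarrow> U \<subseteq> imp V W"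
  shows "open_implication X imp"
  unfolding open_implication_def by (intro conjI allI impI assms)

lemma open_implicationD:
  assumes "open_implication X imp"
  shows "implication X imp"
    and "\<And>U V W. openin X U \<Longrightarrow> openin X V \<Longrightarrow> openin X W \<Longrightarrow> U \<inter> V \<subseteq> W \<Longrightarrow> U \<subseteq> imp V W"
  by (rule assms[unfolded open_implication_def, THEN conjunct1])
    (rule assms[unfolded open_implication_def, THEN conjunct2, rule_format])

lemma closed_implicationI:
  assumes "implication X imp"
    and "\<And>U V W. openin X U \<Longrightarrow> openin X V \<Longrightarrow> openin X W \<Longrightarrow> U \<subseteq> V \<union> W \<Longrightarrow>
      imp U V \<union> W = topspace X"
  shows "closed_implication X imp"
  unfolding closed_implication_def by (intro conjI allI impI assms)

lemma closed_implicationD: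
  assumes "closed_implication X imp"
  shows "implication X imp"
    and "\<And>U V W. openin X U \<Longrightarrow> openin X V \<Longrightarrow> openin X W \<Longrightarrow> U \<subseteq> V \<union> W \<Longrightarrow>
      imp U V \<union> W = topspace X"
  by (rule assms[unfolded closed_implication_def, THEN conjunct1])
    (rule assms[unfolded closed_implication_def, THEN conjunct2, rule_format])

section \<open>Localizability as a condition on single sets\<close>

text \<open>Here \<open>Z\<close> is an arbitrary set, so that the open and the closed case can
  share every argument that concerns one fixed \<open>Z\<close>.\<close>

definition localizable_at :: "'a topology \<Rightarrow> 'a set_op \<Rightarrow> 'a set \<Rightarrow> bool" where
  "localizable_at Y imp Z \<longleftrightarrow>
     (\<forall>U1 V1 U2 V2. openin Y U1 \<longrightarrow> openin Y V1 \<longrightarrow> openin Y U2 \<longrightarrow> openin Y V2 \<longrightarrow>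
        U1 \<inter> Z = U2 \<inter> Z \<longrightarrow> V1 \<inter> Z = V2 \<inter> Z \<longrightarrow> imp U1 V1 \<inter> Z = imp U2 V2 \<inter> Z)"

lemma open_localizable_iff:
  "open_localizable Y imp \<longleftrightarrow> (\<forall>Z. openin Y Z \<longrightarrow> localizable_at Y imp Z)"
  unfolding open_localizable_def localizable_at_def by blast

lemma closed_localizable_iff:
  "closed_localizable Y imp \<longleftrightarrow> (\<forall>Z. closedin Y Z \<longrightarrow> localizable_at Y imp Z)"
  unfolding closed_localizable_def localizable_at_def by blast

lemma localizable_at_iff:
  assumes imp: "implication Y imp" and Z: "Z \<subseteq> topspace Y"
  shows "localizable_at Y imp Z \<longleftrightarrow>
    (\<forall>U V. openin Y U \<longrightarrow> openin Y V \<longrightarrow> U \<inter> Z \<subseteq> V \<longrightarrow> Z \<subseteq> imp U V)" (is "?L \<longleftrightarrow> ?R")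
proof
  assume L: ?L
  show ?R
  proof (intro allI impI)
    fix U V assume UV: "openin Y U" "openin Y V" "U \<inter> Z \<subseteq> V"
    \<comment> \<open>From \<open>U \<inter> Z \<subseteq> V\<close> it follows that
      \<open>U\<close> and \<open>U \<inter> V\<close> have the same trace on
      \<open>Z\<close>.\<close>
    have "imp U V \<inter> Z = imp (U \<inter> V) V \<inter> Z"
      using L[unfolded localizable_at_def, rule_format, of U V "U \<inter> V" V] UV by blast
    also have "\<dots> = Z"
      using implication_le[OF imp, of "U \<inter> V" V] UV Z by auto
    finally show "Z \<subseteq> imp U V" by blast
  qed
next
  assume R: ?R
  \<comment> \<open>The hypotheses are symmetric in the two pairs, so one inclusion suffices. Equal
    traces give \<open>U2 \<inter> Z \<subseteq> U1\<close> and
    \<open>V1 \<inter> Z \<subseteq> V2\<close>; transitivity then runs along \<open>U2\<close>,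
    \<open>U1\<close>, \<open>V1\<close>, \<open>V2\<close>.\<close>
  have le: "imp U1 V1 \<inter> Z \<subseteq> imp U2 V2"
    if o: "openin Y U1" "openin Y V1" "openin Y U2" "openin Y V2"
      and e: "U1 \<inter> Z = U2 \<inter> Z" "V1 \<inter> Z = V2 \<inter> Z" for U1 V1 U2 V2
  proof -
    have "Z \<subseteq> imp U2 U1" "Z \<subseteq> imp V1 V2"
      using R o e by blast+
    moreover have "imp U2 U1 \<inter> imp U1 V1 \<subseteq> imp U2 V1" "imp U2 V1 \<inter> imp V1 V2 \<subseteq> imp U2 V2"
      using implication_trans[OF imp] o by blast+
    ultimately show ?thesis by blast
  qed
  show ?L
    unfolding localizable_at_def
  proof (intro allI impI)
    fix U1 V1 U2 V2
    assume o: "openin Y U1" "openin Y V1" "openin Y U2" "openin Y V2"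
      and e: "U1 \<inter> Z = U2 \<inter> Z" "V1 \<inter> Z = V2 \<inter> Z"
    show "imp U1 V1 \<inter> Z = imp U2 V2 \<inter> Z"
      using le[OF o e] le[OF o(3,4,1,2) e[symmetric]] by blast
  qed
qed

lemma open_localizable_iff_open_implication:
  assumes "implication Y imp"
  shows "open_localizable Y imp \<longleftrightarrow> open_implication Y imp"
proof -
  have "localizable_at Y imp Z \<longleftrightarrow>
      (\<forall>U V. openin Y U \<longrightarrow> openin Y V \<longrightarrow> Z \<inter> U \<subseteq> V \<longrightarrow> Z \<subseteq> imp U V)" if "openin Y Z" for Z
    unfolding localizable_at_iff[OF assms openin_subset[OF that]] by (simp only: Int_commute)
  then show ?thesis
    unfolding open_localizable_iff open_implication_def using assms by simp
qed

text \<open>The open \<open>W\<close> in the definition of closedness corresponds to the closed set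
  \<open>Z = topspace Y - W\<close>: then \<open>U \<subseteq> V \<union> W\<close> says
  \<open>U \<inter> Z \<subseteq> V\<close>, and \<open>imp U V \<union> W = topspace Y\<close> says
  \<open>Z \<subseteq> imp U V\<close>.\<close>

lemma closed_localizable_iff_closed_implication:
  assumes imp: "implication Y imp"
  shows "closed_localizable Y imp \<longleftrightarrow> closed_implication Y imp"
proof
  assume L: "closed_localizable Y imp"
  show "closed_implication Y imp"
    unfolding closed_implication_def
  proof (intro conjI imp allI impI)
    fix U V W assume o: "openin Y U" "openin Y V" "openin Y W" and "U \<subseteq> V \<union> W"
    then have "U \<inter> (topspace Y - W) \<subseteq> V" by blast
    moreover have "localizable_at Y imp (topspace Y - W)"
      using L o unfolding closed_localizable_iff by blast
    ultimately have "topspace Y - W \<subseteq> imp U V"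
      using localizable_at_iff[OF imp] o by blast
    then show "imp U V \<union> W = topspace Y"
      using openin_subset[OF implication_openin[OF imp o(1,2)]] openin_subset[OF o(3)] by blast
  qed
next
  assume C: "closed_implication Y imp"
  show "closed_localizable Y imp"
    unfolding closed_localizable_iff
  proof (intro allI impI)
    fix Z assume Z: "closedin Y Z"
    show "localizable_at Y imp Z"
      unfolding localizable_at_iff[OF imp closedin_subset[OF Z]]
    proof (intro allI impI)
      fix U V assume o: "openin Y U" "openin Y V" and "U \<inter> Z \<subseteq> V"
      then have "U \<subseteq> V \<union> (topspace Y - Z)"
        using openin_subset[OF o(1)] by blast
      then have "imp U V \<union> (topspace Y - Z) = topspace Y"
        using C o Z unfolding closed_implication_def by blast
      then show "Z \<subseteq> imp U V"
        using closedin_subset[OF Z] by blast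
    qed
  qed
qed

section \<open>Pulling an implication back along a map\<close>

definition pullback_op ::
    "'b topology \<Rightarrow> ('b \<Rightarrow> 'a) \<Rightarrow> ('b set \<Rightarrow> 'a set) \<Rightarrow> 'a set_op \<Rightarrow> 'b set_op" where
  "pullback_op X f g imp U V = f -` imp (g U) (g V) \<inter> topspace X"

text \<open>Monotonicity of \<open>g\<close> carries the order laws over from \<open>imp\<close>,
  and taking preimages respects inclusions and intersections. Reflexivity holds since
  \<open>f\<close> maps all of \<open>X\<close> into \<open>topspace Y\<close>.\<close>

lemma implication_pullback_op:
  assumes imp: "implication Y imp" and f: "continuous_map X Y f"
    and g: "\<And>U. openin X U \<Longrightarrow> openin Y (g U)"
    and g_mono: "\<And>U V. openin X U \<Longrightarrow> openin X V \<Longrightarrow> U \<subseteq> V \<Longrightarrow> g U \<subseteq> g V"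
  shows "implication X (pullback_op X f g imp)"
proof -
  show ?thesis
    unfolding implication_def
  proof (intro conjI allI impI)
    show "openin X (pullback_op X f g imp U V)" if "openin X U" "openin X V" for U V
      using openin_continuous_map_preimage[OF f implication_openin[OF imp g[OF that(1)] g[OF that(2)]]]
      unfolding pullback_op_def vimage_def Int_def by (simp only: mem_Collect_eq conj_commute)
    show "pullback_op X f g imp U U = topspace X" if "openin X U" for U
      unfolding pullback_op_def implication_refl[OF imp g[OF that]]
      using continuous_map_image_subset_topspace[OF f] by blast
    show "pullback_op X f g imp U' V \<subseteq> pullback_op X f g imp U V"
      if "openin X U" "openin X U'" "openin X V" "U \<subseteq> U'" for U U' V
      unfolding pullback_op_def
      by (intro Int_mono vimage_mono implication_antimono[OF imp] g g_mono that order_refl)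
    show "pullback_op X f g imp U V \<subseteq> pullback_op X f g imp U V'"
      if "openin X U" "openin X V" "openin X V'" "V \<subseteq> V'" for U V V'
      unfolding pullback_op_def
      by (intro Int_mono vimage_mono implication_mono[OF imp] g g_mono that order_refl)
    show "pullback_op X f g imp U V \<inter> pullback_op X f g imp V W \<subseteq> pullback_op X f g imp U W"
      if "openin X U" "openin X V" "openin X W" for U V W
      unfolding pullback_op_def
      using implication_trans[OF imp g[OF that(1)] g[OF that(2)] g[OF that(3)]] by blast
  qed
qed

text \<open>A preimage under \<open>f\<close> depends only on the trace on the image of
  \<open>f\<close>. Going to \<open>X\<close> and back by \<open>g\<close> leaves the trace of an
  open set there unchanged, and by localizability also that of the implication.\<close>

lemma preserves_implication_pullback_op:
  assumes loc: "localizable_at Y imp (f ` topspace X)" and f: "continuous_map X Y f"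
    and g: "\<And>U. openin X U \<Longrightarrow> openin Y (g U)"
    and gf: "\<And>U. openin Y U \<Longrightarrow>
      g (f -` U \<inter> topspace X) \<inter> f ` topspace X = U \<inter> f ` topspace X"
  shows "preserves_implication X (pullback_op X f g imp) Y imp f"
  unfolding preserves_implication_def pullback_op_def
proof (intro allI impI)
  fix U V assume o: "openin Y U" "openin Y V"
  let ?p = "\<lambda>U. f -` U \<inter> topspace X"
  have "openin X (?p W)" if "openin Y W" for W
    using openin_continuous_map_preimage[OF f that]
    unfolding vimage_def Int_def by (simp only: mem_Collect_eq conj_commute)
  then have "openin Y (g (?p U))" "openin Y (g (?p V))"
    using o g by blast+
  then have "imp U V \<inter> f ` topspace X = imp (g (?p U)) (g (?p V)) \<inter> f ` topspace X"
    by (intro loc[unfolded localizable_at_def, rule_format] o gf[symmetric])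
  then show "?p (imp U V) = ?p (imp (g (?p U)) (g (?p V)))"
    by blast
qed

text \<open>Irreducibility turns \<open>U \<inter> V \<subseteq> W\<close> into the same relation
  between the images, to which openness of \<open>imp\<close> applies. The image of \<open>X\<close>
  is open, so \<open>imp\<close> is localizable at it.\<close>

lemma pulls_back_along_open_irreducible:
  assumes "open_implication Y imp"
  shows "pulls_back_along T open_irreducible open_implication Y imp"
  unfolding pulls_back_along_def
proof (intro allI impI)
  fix X :: "'b topology" and f assume "open_irreducible X Y f"
  then have f: "continuous_map X Y f" and op: "\<And>U. openin X U \<Longrightarrow> openin Y (f ` U)"
    and Int: "\<And>A B. openin X A \<Longrightarrow> openin X B \<Longrightarrow> f ` A \<inter> f ` B = f ` (A \<inter> B)"
    unfolding open_irreducible_def open_map_def by auto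
  have imp: "implication Y imp"
    and opn: "\<And>U V W. openin Y U \<Longrightarrow> openin Y V \<Longrightarrow> openin Y W \<Longrightarrow> U \<inter> V \<subseteq> W \<Longrightarrow> U \<subseteq> imp V W"
    by (fact open_implicationD[OF assms])+
  let ?imp = "pullback_op X f ((`) f) imp"
  have "implication X ?imp"
    by (intro implication_pullback_op[OF imp f] op image_mono)
  moreover have "U \<subseteq> ?imp V W"
    if o: "openin X U" "openin X V" "openin X W" and "U \<inter> V \<subseteq> W" for U V W
  proof -
    have "f ` U \<inter> f ` V \<subseteq> f ` W"
      using Int[OF o(1,2)] \<open>U \<inter> V \<subseteq> W\<close> by blast
    then have "f ` U \<subseteq> imp (f ` V) (f ` W)"
      by (intro opn op o)
    then show ?thesis
      using openin_subset[OF o(1)] unfolding pullback_op_def by blast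
  qed
  ultimately have "open_implication X ?imp"
    by (rule open_implicationI)
  moreover have "localizable_at Y imp (f ` topspace X)"
    using assms open_localizable_iff_open_implication[OF imp] op
    unfolding open_localizable_iff by blast
  then have "preserves_implication X ?imp Y imp f"
    by (rule preserves_implication_pullback_op[OF _ f op]) auto
  ultimately show "\<exists>impX. open_implication X impX \<and> preserves_implication X impX Y imp f"
    by blast
qed

lemma pulls_back_along_closed_irreducible:
  assumes "closed_implication Y imp"
  shows "pulls_back_along T closed_irreducible closed_implication Y imp"
  unfolding pulls_back_along_def
proof (intro allI impI)
  fix X :: "'b topology" and f assume "closed_irreducible X Y f"
  then have f: "continuous_map X Y f" and cl: "\<And>A. closedin X A \<Longrightarrow> closedin Y (f ` A)"
    and Int: "\<And>A B. closedin X A \<Longrightarrow> closedin X B \<Longrightarrow> f ` A \<inter> f ` B = f ` (A \<inter> B)"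
    unfolding closed_irreducible_def closed_map_def by auto
  have imp: "implication Y imp"
    and clo: "\<And>U V W. openin Y U \<Longrightarrow> openin Y V \<Longrightarrow> openin Y W \<Longrightarrow> U \<subseteq> V \<union> W \<Longrightarrow>
      imp U V \<union> W = topspace Y"
    by (fact closed_implicationD[OF assms])+
  \<comment> \<open>This is the right adjoint of the preimage map: \<open>g U\<close> is the largest
    open set of \<open>Y\<close> whose preimage in \<open>X\<close> lies in \<open>U\<close>. It is
    open because \<open>f\<close> is a closed map.\<close>
  define g where "g U = topspace Y - f ` (topspace X - U)" for U
  have fY: "f ` topspace X \<subseteq> topspace Y"
    using continuous_map_image_subset_topspace[OF f] .
  have g: "openin Y (g U)" if "openin X U" for U
    unfolding g_def using cl that by blast
  let ?imp = "pullback_op X f g imp"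
  have "implication X ?imp"
    by (rule implication_pullback_op[OF imp f g]) (auto simp: g_def)
  moreover have "?imp U V \<union> W = topspace X"
    if o: "openin X U" "openin X V" "openin X W" and "U \<subseteq> V \<union> W" for U V W
  proof -
    \<comment> \<open>Irreducibility is applied to complements, so that a cover of \<open>U\<close>
      by \<open>V\<close> and \<open>W\<close> becomes a cover of \<open>g U\<close> by
      \<open>g V\<close> and \<open>g W\<close>.\<close>
    have "f ` (topspace X - V) \<inter> f ` (topspace X - W) = f ` ((topspace X - V) \<inter> (topspace X - W))"
      using Int o by blast
    then have "f ` (topspace X - V) \<inter> f ` (topspace X - W) \<subseteq> f ` (topspace X - U)"
      using \<open>U \<subseteq> V \<union> W\<close> by blast
    then have "g U \<subseteq> g V \<union> g W"
      unfolding g_def by blast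
    then have "imp (g U) (g V) \<union> g W = topspace Y"
      by (intro clo g o)
    \<comment> \<open>This is the counit of the adjunction; it allows the preimage of
      \<open>g W\<close> to be replaced by \<open>W\<close> in the cover of
      \<open>X\<close>.\<close>
    moreover have "f -` g W \<inter> topspace X \<subseteq> W"
      unfolding g_def by blast
    ultimately have "topspace X \<subseteq> ?imp U V \<union> W"
      using fY unfolding pullback_op_def by blast
    then show ?thesis
      using openin_subset[OF o(3)] unfolding pullback_op_def by blast
  qed
  ultimately have "closed_implication X ?imp"
    by (rule closed_implicationI)
  moreover have "localizable_at Y imp (f ` topspace X)"
    using assms closed_localizable_iff_closed_implication[OF imp] cl
    unfolding closed_localizable_iff by blast
  then have "preserves_implication X ?imp Y imp f"
    by (rule preserves_implication_pullback_op[OF _ f g])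
      (use fY in \<open>auto simp: g_def\<close>)
  ultimately show "\<exists>impX. closed_implication X impX \<and> preserves_implication X impX Y imp f"
    by blast
qed

section \<open>Embeddings as irreducible maps\<close>

text \<open>Injectivity makes images commute with intersections, and a set open in an open subspace
  is open in \<open>Y\<close>.\<close>

lemma open_embedding_imp_open_irreducible:
  assumes "open_embedding X Y f"
  shows "open_irreducible X Y f"
proof -
  have h: "homeomorphic_map X (subtopology Y (f ` topspace X)) f" and o: "openin Y (f ` topspace X)"
    using assms unfolding open_embedding_def embedding_map_def by auto
  have inj: "inj_on f (topspace X)"
    using h by (rule homeomorphic_imp_injective_map)
  have "f ` A \<inter> f ` B = f ` (A \<inter> B)" if "openin X A" "openin X B" for A B
    using inj_on_image_Int[OF inj openin_subset[OF that(1)] openin_subset[OF that(2)]] by blast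
  moreover have "continuous_map X Y f"
    using homeomorphic_imp_continuous_map[OF h] continuous_map_in_subtopology by blast
  moreover have "open_map X Y f"
    using homeomorphic_imp_open_map[OF h] openin_open_subtopology[OF o]
    unfolding open_map_def by blast
  ultimately show ?thesis
    unfolding open_irreducible_def by blast
qed

lemma closed_embedding_imp_closed_irreducible:
  assumes "closed_embedding X Y f"
  shows "closed_irreducible X Y f"
proof -
  have h: "homeomorphic_map X (subtopology Y (f ` topspace X)) f" and c: "closedin Y (f ` topspace X)"
    using assms unfolding closed_embedding_def embedding_map_def by auto
  have inj: "inj_on f (topspace X)"
    using h by (rule homeomorphic_imp_injective_map)
  have "f ` A \<inter> f ` B = f ` (A \<inter> B)" if "closedin X A" "closedin X B" for A B
    using inj_on_image_Int[OF inj closedin_subset[OF that(1)] closedin_subset[OF that(2)]] by blast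
  moreover have "continuous_map X Y f"
    using homeomorphic_imp_continuous_map[OF h] continuous_map_in_subtopology by blast
  moreover have "closed_map X Y f"
    using homeomorphic_imp_closed_map[OF h] closedin_closed_subtopology[OF c]
    unfolding closed_map_def by blast
  ultimately show ?thesis
    unfolding closed_irreducible_def by blast
qed

section \<open>Localizability from inclusions of subspaces\<close>

lemma embedding_map_subtopology:
  assumes "Z \<subseteq> topspace Y"
  shows "embedding_map (subtopology Y Z) Y id" "id ` topspace (subtopology Y Z) = Z"
  using assms by (auto simp: embedding_map_def topspace_subtopology Int_absorb1)

text \<open>Preimages under the inclusion of \<open>Z\<close> are traces on \<open>Z\<close>, so
  preservation exhibits the trace of \<open>imp U V\<close> as a function of the traces of
  \<open>U\<close> and \<open>V\<close>.\<close>

lemma localizable_at_if_preserves_implication: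
  assumes imp: "implication Y imp" and Z: "Z \<subseteq> topspace Y"
    and "preserves_implication (subtopology Y Z) impX Y imp id"
  shows "localizable_at Y imp Z"
proof -
  have "imp U V \<inter> Z = impX (U \<inter> Z) (V \<inter> Z)" if "openin Y U" "openin Y V" for U V
    using assms(3) that Z unfolding preserves_implication_def
    by (simp add: topspace_subtopology Int_absorb1)
  then show ?thesis
    unfolding localizable_at_def by metis
qed

text \<open>A subspace of \<open>Y\<close> has its points in the type of \<open>Y\<close>, and its
  inclusion is \<open>id\<close>; hence the hypothesis at the type \<open>'a\<close> covers every
  open \<open>Z\<close>.\<close>

lemma open_localizable_if_pulls_back:
  fixes Y :: "'a topology"
  assumes "implication Y imp" "pulls_back_along TYPE('a) open_embedding implication Y imp"
  shows "open_localizable Y imp"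
  unfolding open_localizable_iff
proof (intro allI impI)
  fix Z assume Z: "openin Y Z"
  have "open_embedding (subtopology Y Z) Y id"
    unfolding open_embedding_def using embedding_map_subtopology[OF openin_subset[OF Z]] Z by simp
  then show "localizable_at Y imp Z"
    using assms(2) localizable_at_if_preserves_implication[OF assms(1) openin_subset[OF Z]]
    unfolding pulls_back_along_def by blast
qed

lemma closed_localizable_if_pulls_back:
  fixes Y :: "'a topology"
  assumes "implication Y imp" "pulls_back_along TYPE('a) closed_embedding implication Y imp"
  shows "closed_localizable Y imp"
  unfolding closed_localizable_iff
proof (intro allI impI)
  fix Z assume Z: "closedin Y Z"
  have "closed_embedding (subtopology Y Z) Y id"
    unfolding closed_embedding_def
    using embedding_map_subtopology[OF closedin_subset[OF Z]] Z by simp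
  then show "localizable_at Y imp Z"
    using assms(2) localizable_at_if_preserves_implication[OF assms(1) closedin_subset[OF Z]]
    unfolding pulls_back_along_def by blast
qed

section \<open>The two cycles of conditions\<close>

lemma pulls_back_along_mono:
  assumes "pulls_back_along T M C Y imp"
    and "\<And>X f. M' X Y f \<Longrightarrow> M X Y f" "\<And>X impX. C X impX \<Longrightarrow> C' X impX"
  shows "pulls_back_along T M' C' Y imp"
  using assms unfolding pulls_back_along_def by meson

lemma pulls_back_along_open_weaken:
  "pulls_back_along T open_irreducible open_implication Y imp \<Longrightarrow>
    pulls_back_along T open_irreducible implication Y imp"
  "pulls_back_along T open_irreducible implication Y imp \<Longrightarrow>
    pulls_back_along T open_embedding implication Y imp"
  by (erule pulls_back_along_mono;
      simp add: open_implication_def open_embedding_imp_open_irreducible)+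

lemma pulls_back_along_closed_weaken:
  "pulls_back_along T closed_irreducible closed_implication Y imp \<Longrightarrow>
    pulls_back_along T closed_irreducible implication Y imp"
  "pulls_back_along T closed_irreducible implication Y imp \<Longrightarrow>
    pulls_back_along T closed_embedding implication Y imp"
  by (erule pulls_back_along_mono;
      simp add: closed_implication_def closed_embedding_imp_closed_irreducible)+

lemma all_equivalent_cycle:
  assumes "P1 \<Longrightarrow> P2" "P2 \<Longrightarrow> P3" "P3 \<Longrightarrow> P4" "P4 \<Longrightarrow> P5" "P5 \<Longrightarrow> P1"
  shows "all_equivalent [P1, P2, P3, P4, P5]"
  using assms unfolding all_equivalent_def by auto

theorem theorem3p23:
  fixes Y :: "'a topology" and imp :: "'a set \<Rightarrow> 'a set \<Rightarrow> 'a set"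
  assumes "implication Y imp"
  shows
    "all_equivalent
       [pulls_back_along TYPE('a) open_irreducible open_implication Y imp \<and>
        pulls_back_along TYPE('b) open_irreducible open_implication Y imp,
        pulls_back_along TYPE('a) open_irreducible implication Y imp \<and>
        pulls_back_along TYPE('b) open_irreducible implication Y imp,
        pulls_back_along TYPE('a) open_embedding implication Y imp \<and>
        pulls_back_along TYPE('b) open_embedding implication Y imp,
        open_localizable Y imp,
        open_implication Y imp] \<and>
     all_equivalent
       [pulls_back_along TYPE('a) closed_irreducible closed_implication Y imp \<and>
        pulls_back_along TYPE('b) closed_irreducible closed_implication Y imp,
        pulls_back_along TYPE('a) closed_irreducible implication Y imp \<and>
        pulls_back_along TYPE('b) closed_irreducible implication Y imp,
        pulls_back_along TYPE('a) closed_embedding implication Y imp \<and>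
        pulls_back_along TYPE('b) closed_embedding implication Y imp,
        closed_localizable Y imp,
        closed_implication Y imp]"
  \<comment> \<open>In each cycle, two weakenings lead to embeddings, the instance at
    \<open>'a\<close> gives localizability, and localizability gives openness or closedness of
    \<open>imp\<close>. The pullback construction works over any point type and so returns both
    instances of the first condition.\<close>
  by (intro conjI all_equivalent_cycle)
    (simp_all add: pulls_back_along_open_weaken pulls_back_along_closed_weaken
      open_localizable_if_pulls_back[OF assms] closed_localizable_if_pulls_back[OF assms]
      pulls_back_along_open_irreducible pulls_back_along_closed_irreducible
      open_localizable_iff_open_implication[OF assms, THEN iffD1]
      closed_localizable_iff_closed_implication[OF assms, THEN iffD1])

end
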